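(* Let $M$ be a connected simple matroid of rank $3$ on $E$ with rank function $r$, and let $A\subseteq E$. Then $\mathcal{B}(M)$ is 2-decomposable by the hyperplane $(A,2)_=$ if and only if the following three conditions hold: (1) $|E\setminus A|\ge 2$; (2) $r(A)=3$; (3) for every $F\subseteq E$ such that $(F,2)_\le$ is a facet-defining inequality of $\mathcal{B}(M)$, at least one of the following holds: (3-1) $|A\cap F|\le 1$; (3-2) $F\subseteq A$; (3-3) $A\cup F=E$.
   Context: For $A\subseteq E$ and an integer $a$, $(A,a)_\le=\{I\subseteq E:|I\cap A|\le a\}$, and similarly $(A,a)_\ge,(A,a)_<,(A,a)_>,(A,a)_=$ with the corresponding relation on $|I\cap A|$. $\mathcal{B}(M)$ is the family of bases of $M$. A face of $\mathcal{B}(M)$ is a family $\mathcal{B}(M)\cap\bigcap_i(A_i,r(A_i))_=$; a facet is a maximal proper face; $(F,r(F))_\le$ is facet-defining if $\mathcal{B}(M)\cap(F,r(F))_=$ is a facet. $\mathcal{B}(M)$ is 2-decomposable by the hyperplane $(A,a)_=$ if $\mathcal{B}(M)\cap(A,a)_\ge$ and $\mathcal{B}(M)\cap(A,a)_\le$ are both base families of matroids on $E$, and $\mathcal{B}(M)\cap(A,a)_>$ and $\mathcal{B}(M)\cap(A,a)_<$ are both non-empty. *)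

theory Defs
  imports Main
begin

text \<open>A finite matroid on the ground set \<open>E\<close>, given by its independent sets.\<close>

locale matroid =
  fixes E :: "'a set" and indep :: "'a set \<Rightarrow> bool"
  assumes finite_ground: "finite E"
    and indep_subset_ground: "indep I \<Longrightarrow> I \<subseteq> E"
    and indep_empty: "indep {}"
    and indep_subset: "indep I \<Longrightarrow> J \<subseteq> I \<Longrightarrow> indep J"
    and augment: "indep I \<Longrightarrow> indep J \<Longrightarrow> card I < card J \<Longrightarrow> \<exists>x\<in>J - I. indep (insert x I)"

definition rank_of :: "('a set \<Rightarrow> bool) \<Rightarrow> 'a set \<Rightarrow> nat" where
  "rank_of indep A = Max (card ` {I. I \<subseteq> A \<and> indep I})"

definition bases :: "('a set \<Rightarrow> bool) \<Rightarrow> 'a set set" where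
  "bases indep = {B. indep B \<and> (\<forall>I. indep I \<and> B \<subseteq> I \<longrightarrow> I = B)}"

definition base_family_on :: "'a set \<Rightarrow> 'a set set \<Rightarrow> bool" where
  "base_family_on E \<B> \<longleftrightarrow> (\<exists>indep. matroid E indep \<and> \<B> = bases indep)"

text \<open>Connected: there is no separator other than \<open>{}\<close> and \<open>E\<close>.\<close>

definition connected_matroid :: "'a set \<Rightarrow> ('a set \<Rightarrow> bool) \<Rightarrow> bool" where
  "connected_matroid E indep \<longleftrightarrow>
    (\<forall>X. X \<noteq> {} \<and> X \<subset> E \<longrightarrow>
      rank_of indep E < rank_of indep X + rank_of indep (E - X))"

definition is_loop :: "'a set \<Rightarrow> ('a set \<Rightarrow> bool) \<Rightarrow> 'a \<Rightarrow> bool" where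
  "is_loop E indep e \<longleftrightarrow> e \<in> E \<and> \<not> indep {e}"

definition is_parallel :: "'a set \<Rightarrow> ('a set \<Rightarrow> bool) \<Rightarrow> 'a \<Rightarrow> 'a \<Rightarrow> bool" where
  "is_parallel E indep e f \<longleftrightarrow>
    e \<in> E \<and> f \<in> E \<and> e \<noteq> f \<and> \<not> is_loop E indep e \<and> \<not> is_loop E indep f \<and> \<not> indep {e, f}"

definition simple_matroid :: "'a set \<Rightarrow> ('a set \<Rightarrow> bool) \<Rightarrow> bool" where
  "simple_matroid E indep \<longleftrightarrow>
    (\<nexists>e. is_loop E indep e) \<and> (\<nexists>e f. is_parallel E indep e f)"

text \<open>The families \<open>(A,a)\<^sub>R\<close> for \<open>R\<close> one of \<open>\<le>, \<ge>, <, >, =\<close>.\<close>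

definition fam_le :: "'a set \<Rightarrow> 'a set \<Rightarrow> int \<Rightarrow> 'a set set" where
  "fam_le E A a = {I. I \<subseteq> E \<and> int (card (I \<inter> A)) \<le> a}"

definition fam_ge :: "'a set \<Rightarrow> 'a set \<Rightarrow> int \<Rightarrow> 'a set set" where
  "fam_ge E A a = {I. I \<subseteq> E \<and> int (card (I \<inter> A)) \<ge> a}"

definition fam_less :: "'a set \<Rightarrow> 'a set \<Rightarrow> int \<Rightarrow> 'a set set" where
  "fam_less E A a = {I. I \<subseteq> E \<and> int (card (I \<inter> A)) < a}"

definition fam_greater :: "'a set \<Rightarrow> 'a set \<Rightarrow> int \<Rightarrow> 'a set set" where
  "fam_greater E A a = {I. I \<subseteq> E \<and> int (card (I \<inter> A)) > a}"

definition fam_eq :: "'a set \<Rightarrow> 'a set \<Rightarrow> int \<Rightarrow> 'a set set" where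
  "fam_eq E A a = {I. I \<subseteq> E \<and> int (card (I \<inter> A)) = a}"

text \<open>The empty intersection is allowed, so \<open>bases indep\<close> is itself a face.\<close>

definition is_face :: "'a set \<Rightarrow> ('a set \<Rightarrow> bool) \<Rightarrow> 'a set set \<Rightarrow> bool" where
  "is_face E indep \<F> \<longleftrightarrow>
    (\<exists>\<A>. \<A> \<subseteq> Pow E \<and>
      \<F> = bases indep \<inter> (\<Inter>A\<in>\<A>. fam_eq E A (int (rank_of indep A))))"

definition is_facet :: "'a set \<Rightarrow> ('a set \<Rightarrow> bool) \<Rightarrow> 'a set set \<Rightarrow> bool" where
  "is_facet E indep \<F> \<longleftrightarrow>
    is_face E indep \<F> \<and> \<F> \<noteq> bases indep \<and>
    (\<forall>\<G>. is_face E indep \<G> \<and> \<G> \<noteq> bases indep \<and> \<F> \<subseteq> \<G> \<longrightarrow> \<G> = \<F>)"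

text \<open>
  Only the inequalities \<open>(F,r(F))\<^sub>\<le>\<close> are called facet-defining, so \<open>a = r(F)\<close> is part of the notion.
\<close>

definition facet_defining :: "'a set \<Rightarrow> ('a set \<Rightarrow> bool) \<Rightarrow> 'a set \<Rightarrow> int \<Rightarrow> bool" where
  "facet_defining E indep F a \<longleftrightarrow>
    F \<subseteq> E \<and> a = int (rank_of indep F) \<and> is_facet E indep (bases indep \<inter> fam_eq E F a)"

definition two_decomposable :: "'a set \<Rightarrow> 'a set set \<Rightarrow> 'a set \<Rightarrow> int \<Rightarrow> bool" where
  "two_decomposable E \<B> A a \<longleftrightarrow>
    base_family_on E (\<B> \<inter> fam_ge E A a) \<and> base_family_on E (\<B> \<inter> fam_le E A a) \<and>
    \<B> \<inter> fam_greater E A a \<noteq> {} \<and> \<B> \<inter> fam_less E A a \<noteq> {}"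

end

theory Submission
  imports Defs
begin

text \<open>
  A family of triples is a base family once it satisfies basis exchange, so 2-decomposability is
  an exchange property of the bases meeting \<open>A\<close> in at least (at most) two points. Exchanging \<open>x\<close>
  out of \<open>{x, p, q}\<close> can be obstructed only when the line through \<open>p\<close> and \<open>q\<close> contains two points
  of \<open>A\<close> and a point outside \<open>A\<close>, and does not cover \<open>E - A\<close>. Such a line has three points, and
  connectedness makes every line with at least three points facet-defining; conversely a
  facet-defining set of rank two is closed, hence a line.
\<close>

section \<open>Rank, bases and basis exchange in a matroid\<close>

context matroid
begin

lemma finite_indep: "indep I \<Longrightarrow> finite I"
  using finite_ground indep_subset_ground finite_subset by blast

lemma finite_card_indep: "finite (card ` {I. I \<subseteq> X \<and> indep I})"
proof -
  have "{I. I \<subseteq> X \<and> indep I} \<subseteq> Pow E"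
    using indep_subset_ground by blast
  then show ?thesis
    using finite_ground finite_subset by blast
qed

lemma card_le_rank: "indep I \<Longrightarrow> I \<subseteq> X \<Longrightarrow> card I \<le> rank_of indep X"
  unfolding rank_of_def by (rule Max_ge[OF finite_card_indep]) blast

lemma rank_attained: "\<exists>I. I \<subseteq> X \<and> indep I \<and> card I = rank_of indep X"
proof -
  have "card ` {I. I \<subseteq> X \<and> indep I} \<noteq> {}"
    using indep_empty by blast
  from Max_in[OF finite_card_indep this] show ?thesis
    unfolding rank_of_def by auto
qed

lemma rank_leI: "(\<And>I. indep I \<Longrightarrow> I \<subseteq> X \<Longrightarrow> card I \<le> n) \<Longrightarrow> rank_of indep X \<le> n"
  using rank_attained[of X] by metis

text \<open>As long as \<open>I\<close> is smaller than the rank of \<open>X\<close>, an independent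
  subset of \<open>X\<close> of maximum size augments it without leaving \<open>X\<close>. The
  induction is on the number of missing elements.\<close>

lemma extend_indep:
  assumes "indep I" "I \<subseteq> X"
  shows "\<exists>J. I \<subseteq> J \<and> J \<subseteq> X \<and> indep J \<and> card J = rank_of indep X"
  using assms
proof (induction "rank_of indep X - card I" arbitrary: I)
  case 0
  then show ?case using card_le_rank[of I X] by fastforce
next
  case (Suc n)
  obtain J where J: "J \<subseteq> X" "indep J" "card J = rank_of indep X"
    using rank_attained by blast
  then obtain x where x: "x \<in> J - I" "indep (insert x I)"
    using augment[of I J] Suc.hyps(2) Suc.prems by fastforce
  have "card (insert x I) = Suc (card I)"
    using x finite_indep Suc.prems by simp
  then have "n = rank_of indep X - card (insert x I)" "insert x I \<subseteq> X"
    using Suc.hyps(2) Suc.prems x J by auto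
  then obtain K where "insert x I \<subseteq> K" "K \<subseteq> X" "indep K" "card K = rank_of indep X"
    using Suc.hyps(1)[of "insert x I"] x by blast
  then show ?case by auto
qed

text \<open>A maximal independent set extends to one of full rank, hence already has that size;
  conversely no independent set is larger than the rank.\<close>

lemma bases_iff: "B \<in> bases indep \<longleftrightarrow> indep B \<and> card B = rank_of indep E"
proof
  assume B: "B \<in> bases indep"
  then have i: "indep B" unfolding bases_def by blast
  then obtain J where J: "B \<subseteq> J" "indep J" "card J = rank_of indep E"
    using extend_indep[OF i indep_subset_ground[OF i]] by blast
  then have "J = B" using B unfolding bases_def by blast
  with J show "indep B \<and> card B = rank_of indep E" by simp
next
  assume B: "indep B \<and> card B = rank_of indep E"
  have "I = B" if "indep I" "B \<subseteq> I" for I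
  proof -
    have "card I \<le> card B" using B card_le_rank that(1) indep_subset_ground by simp
    then show ?thesis using card_seteq[OF finite_indep[OF that(1)] that(2)] by blast
  qed
  then show "B \<in> bases indep" using B unfolding bases_def by blast
qed

text \<open>Augmenting \<open>B - {x}\<close> from \<open>C\<close> adds a point outside
  \<open>B\<close>, because \<open>x\<close> is not in \<open>C\<close>.\<close>

lemma bases_exchange:
  assumes "B \<in> bases indep" "C \<in> bases indep" "x \<in> B - C"
  shows "\<exists>y\<in>C - B. insert y (B - {x}) \<in> bases indep"
proof -
  have B: "indep B" "card B = rank_of indep E" and C: "indep C" "card C = rank_of indep E"
    using assms(1,2) bases_iff by simp_all
  have c: "Suc (card (B - {x})) = card B"
    using assms(3) by (intro card_Suc_Diff1 finite_indep B) auto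
  then have "card (B - {x}) < card C" using B(2) C(2) by simp
  moreover have "indep (B - {x})" using indep_subset[OF B(1)] by blast
  ultimately obtain y where y: "y \<in> C - (B - {x})" "indep (insert y (B - {x}))"
    using augment C(1) by blast
  have "card (insert y (B - {x})) = rank_of indep E"
    using y(1) c B(2) finite_indep[OF B(1)] by simp
  then have "insert y (B - {x}) \<in> bases indep" using y(2) bases_iff by simp
  then show ?thesis using y(1) assms(3) by blast
qed

end

section \<open>Matroids from families with the exchange property\<close>

text \<open>The subsets of members serve as independent sets. If \<open>J\<close> failed to augment
  a smaller \<open>I\<close>, then members \<open>B\<close> containing \<open>I\<close> and
  \<open>C\<close> containing \<open>J\<close>, with \<open>C\<close> as close to \<open>B\<close>
  as possible, would force \<open>card (J - I) \<le> card (I - J)\<close>.\<close>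

lemma base_family_on_exchangeI:
  assumes E: "finite E" and ne: "\<B> \<noteq> {}"
    and sub: "\<And>B. B \<in> \<B> \<Longrightarrow> B \<subseteq> E" and crd: "\<And>B. B \<in> \<B> \<Longrightarrow> card B = n"
    and exch: "\<And>B C x. B \<in> \<B> \<Longrightarrow> C \<in> \<B> \<Longrightarrow> x \<in> B - C \<Longrightarrow> \<exists>y\<in>C - B. insert y (B - {x}) \<in> \<B>"
  shows "base_family_on E \<B>"
proof -
  define ind where "ind I \<longleftrightarrow> (\<exists>B\<in>\<B>. I \<subseteq> B)" for I
  have fin: "finite B" if "B \<in> \<B>" for B
    using sub[OF that] E finite_subset by blast
  have aug: "\<exists>x\<in>J - I. ind (insert x I)" if "ind I" "ind J" and lt: "card I < card J" for I J
  proof (rule ccontr)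
    assume no: "\<not> ?thesis"
    obtain B where B: "B \<in> \<B>" "I \<subseteq> B" using \<open>ind I\<close> unfolding ind_def by blast
    \<comment> \<open>A base \<open>C \<supseteq> J\<close> closest to \<open>B\<close> adds to \<open>J\<close> only elements of \<open>B\<close>.\<close>
    define P where "P C \<longleftrightarrow> C \<in> \<B> \<and> J \<subseteq> C" for C
    have "\<exists>C. P C" using \<open>ind J\<close> unfolding ind_def P_def by blast
    then obtain C where C: "P C"
      and min: "\<And>D. P D \<Longrightarrow> card (C - (J \<union> B)) \<le> card (D - (J \<union> B))"
      using ex_has_least_nat[of P _ "\<lambda>C. card (C - (J \<union> B))"] by blast
    have CB: "C \<in> \<B>" "J \<subseteq> C" using C P_def by auto
    \<comment> \<open>A point of \<open>J \<inter> B\<close> outside \<open>I\<close> would augment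
      \<open>I\<close> within \<open>B\<close>.\<close>
    have JB: "J \<inter> B \<subseteq> I" using no B unfolding ind_def by blast
    have CJ: "C \<subseteq> J \<union> B"
    proof
      fix x assume x: "x \<in> C"
      show "x \<in> J \<union> B"
      proof (rule ccontr)
        assume nx: "x \<notin> J \<union> B"
        obtain y where y: "y \<in> B - C" "insert y (C - {x}) \<in> \<B>"
          using exch[OF CB(1) B(1)] x nx by blast
        have "P (insert y (C - {x}))" using y CB nx P_def by blast
        then have "card (C - (J \<union> B)) \<le> card (insert y (C - {x}) - (J \<union> B))"
          by (rule min)
        also have "insert y (C - {x}) - (J \<union> B) = (C - (J \<union> B)) - {x}"
          using y(1) by blast
        also have "card \<dots> < card (C - (J \<union> B))"
          using x nx fin[OF CB(1)] by (intro card_Diff1_less) auto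
        finally show False by simp
      qed
    qed
    \<comment> \<open>A point of \<open>B\<close> outside \<open>C \<union> I\<close> could be
      exchanged for some \<open>y\<close> in \<open>C - B\<close>, which lies in \<open>J\<close>;
      the new member still contains \<open>I\<close>, so \<open>y\<close> would augment
      \<open>I\<close>.\<close>
    have BI: "B \<subseteq> C \<union> I"
    proof
      fix x assume x: "x \<in> B"
      show "x \<in> C \<union> I"
      proof (rule ccontr)
        assume nx: "x \<notin> C \<union> I"
        obtain y where y: "y \<in> C - B" "insert y (B - {x}) \<in> \<B>"
          using exch[OF B(1) CB(1)] x nx by blast
        have "y \<in> J - I" using y CJ B by blast
        moreover have "insert y I \<subseteq> insert y (B - {x})" using nx B(2) by blast
        then have "ind (insert y I)" using y(2) unfolding ind_def by blast
        ultimately show False using no by blast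
      qed
    qed
    have f: "finite I" "finite J"
      using B(2) CB(2) fin[OF B(1)] fin[OF CB(1)] by (auto intro: finite_subset)
    \<comment> \<open>Members have equal size, while \<open>J - I \<subseteq> C - B\<close> and
      \<open>B - C \<subseteq> I - J\<close>.\<close>
    have "card (C - B) = card (B - C)"
      using card_le_sym_Diff[OF fin[OF B(1)] fin[OF CB(1)]]
        card_le_sym_Diff[OF fin[OF CB(1)] fin[OF B(1)]] crd[OF B(1)] crd[OF CB(1)] by simp
    moreover have "card (J - I) \<le> card (C - B)"
      using JB CB(2) by (intro card_mono finite_Diff fin CB) auto
    moreover have "card (B - C) \<le> card (I - J)"
      using BI CB(2) f by (intro card_mono) auto
    ultimately have "card (J - I) \<le> card (I - J)" by simp
    then show False using lt card_less_sym_Diff[OF f] by simp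
  qed
  have m: "matroid E ind"
  proof
    show "finite E" by (rule E)
    show "I \<subseteq> E" if "ind I" for I using that sub unfolding ind_def by blast
    show "ind {}" using ne unfolding ind_def by blast
    show "ind J" if "ind I" "J \<subseteq> I" for I J using that unfolding ind_def by blast
  qed (rule aug)
  have "\<B> = bases ind"
  proof
    show "\<B> \<subseteq> bases ind"
    proof
      fix B assume B: "B \<in> \<B>"
      have "I = B" if "ind I" "B \<subseteq> I" for I
      proof -
        obtain C where C: "C \<in> \<B>" "I \<subseteq> C" using \<open>ind I\<close> unfolding ind_def by blast
        moreover have "B \<subseteq> C" using C(2) that(2) by blast
        ultimately have "B = C" using card_subset_eq[OF fin, of C B] crd B by simp
        then show ?thesis using C \<open>B \<subseteq> I\<close> by blast
      qed
      moreover have "ind B" using B unfolding ind_def by blast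
      ultimately show "B \<in> bases ind" unfolding bases_def by blast
    qed
    show "bases ind \<subseteq> \<B>"
    proof
      fix B assume B: "B \<in> bases ind"
      then have "ind B" and max: "\<And>I. ind I \<Longrightarrow> B \<subseteq> I \<Longrightarrow> I = B" unfolding bases_def by blast+
      then obtain C where C: "C \<in> \<B>" "B \<subseteq> C" unfolding ind_def by blast
      moreover have "ind C" using C(1) unfolding ind_def by blast
      ultimately have "C = B" using max by blast
      with C show "B \<in> \<B>" by blast
    qed
  qed
  with m show ?thesis unfolding base_family_on_def by blast
qed

lemma base_family_on_exchange:
  assumes "base_family_on E \<B>" "B \<in> \<B>" "C \<in> \<B>" "x \<in> B - C"
  shows "\<exists>y\<in>C - B. insert y (B - {x}) \<in> \<B>"
proof -
  obtain ind where "matroid E ind" "\<B> = bases ind"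
    using assms(1) unfolding base_family_on_def by blast
  then show ?thesis using matroid.bases_exchange[of E ind B C x] assms(2-4) by simp
qed

section \<open>Lines in a connected simple matroid of rank 3\<close>

locale connected_simple_rank3 = matroid +
  assumes connected: "connected_matroid E indep"
    and simple: "simple_matroid E indep"
    and rank3: "rank_of indep E = 3"
begin

abbreviation \<B> where "\<B> \<equiv> bases indep"

text \<open>Since bases have three elements, \<open>p\<close> and \<open>q\<close> themselves belong to \<open>line p q\<close>.\<close>

definition line :: "'a \<Rightarrow> 'a \<Rightarrow> 'a set" where
  "line p q = {y \<in> E. {p, q, y} \<notin> \<B>}"

lemma bases_iff3: "B \<in> \<B> \<longleftrightarrow> indep B \<and> card B = 3"
  using bases_iff rank3 by simp

lemma base_subset: "B \<in> \<B> \<Longrightarrow> B \<subseteq> E"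
  using bases_iff3 indep_subset_ground by blast

lemma base_in_fam:
  assumes "B \<in> \<B>"
  shows "B \<in> fam_eq E X a \<longleftrightarrow> int (card (B \<inter> X)) = a"
    and "B \<in> fam_ge E X a \<longleftrightarrow> int (card (B \<inter> X)) \<ge> a"
    and "B \<in> fam_le E X a \<longleftrightarrow> int (card (B \<inter> X)) \<le> a"
    and "B \<in> fam_greater E X a \<longleftrightarrow> int (card (B \<inter> X)) > a"
    and "B \<in> fam_less E X a \<longleftrightarrow> int (card (B \<inter> X)) < a"
  using base_subset[OF assms]
  by (simp_all add: fam_eq_def fam_ge_def fam_le_def fam_greater_def fam_less_def)

text \<open>For \<open>p = q\<close> this is the absence of loops, otherwise the absence of parallel
  pairs.\<close>

lemma indep_pair: "p \<in> E \<Longrightarrow> q \<in> E \<Longrightarrow> indep {p, q}"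
  using simple unfolding simple_matroid_def is_loop_def is_parallel_def
  by (metis insert_absorb2)

lemma line_subset: "line p q \<subseteq> E"
  by (auto simp: line_def)

lemma mem_line: "p \<in> E \<Longrightarrow> p \<in> line p q" "q \<in> E \<Longrightarrow> q \<in> line p q"
  by (auto simp: line_def bases_iff3 card_insert_if split: if_splits)

text \<open>A larger independent set would augment \<open>{p, q}\<close> by a point of the line to a
  base, which the definition of \<open>line\<close> forbids.\<close>

lemma indep_line_le:
  assumes "p \<in> E" "q \<in> E" "p \<noteq> q" "indep I" "I \<subseteq> line p q"
  shows "card I \<le> 2"
proof (rule ccontr)
  assume "\<not> card I \<le> 2"
  then obtain x where x: "x \<in> I - {p, q}" "indep (insert x {p, q})"
    using augment[of "{p, q}" I] indep_pair assms by auto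
  moreover have "insert x {p, q} = {p, q, x}" by auto
  moreover have "card {p, q, x} = 3" using x assms by auto
  ultimately show False using assms(5) by (auto simp: line_def bases_iff3)
qed

lemma rank_line:
  assumes "p \<in> E" "q \<in> E" "p \<noteq> q"
  shows "rank_of indep (line p q) = 2"
proof (rule antisym)
  show "rank_of indep (line p q) \<le> 2"
    using rank_leI indep_line_le assms by blast
  show "2 \<le> rank_of indep (line p q)"
    using card_le_rank[of "{p, q}" "line p q"] indep_pair mem_line assms by auto
qed

text \<open>Any two points of a line span it: augmenting \<open>{a, b}\<close> from the base
  \<open>{p, q, c}\<close> has to use \<open>c\<close>, since \<open>p\<close> or \<open>q\<close>
  would give three independent points on the line.\<close>

lemma base_off_line:
  assumes "p \<in> E" "q \<in> E" "p \<noteq> q" "a \<in> line p q" "b \<in> line p q" "a \<noteq> b"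
    "c \<in> E" "c \<notin> line p q"
  shows "{a, b, c} \<in> \<B>"
proof -
  have pqc: "{p, q, c} \<in> \<B>" using assms by (auto simp: line_def)
  have "indep {a, b}" using indep_pair line_subset assms by blast
  moreover have "card {a, b} < card {p, q, c}" using pqc assms by (simp add: bases_iff3)
  ultimately obtain x where x: "x \<in> {p, q, c} - {a, b}" "indep (insert x {a, b})"
    using augment[of "{a, b}" "{p, q, c}"] pqc bases_iff3 by blast
  have c3: "card (insert x {a, b}) = 3" using x assms by auto
  have "x = c"
  proof (rule ccontr)
    assume "x \<noteq> c"
    then have "insert x {a, b} \<subseteq> line p q" using x assms mem_line by auto
    then show False using indep_line_le[OF assms(1-3) x(2)] c3 by simp
  qed
  then show ?thesis using x c3 by (simp add: bases_iff3 insert_commute)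
qed

lemma base_inter_line_le:
  assumes "p \<in> E" "q \<in> E" "p \<noteq> q" "B \<in> \<B>"
  shows "card (B \<inter> line p q) \<le> 2"
proof -
  have "indep B" using assms(4) by (simp add: bases_iff3)
  then have "indep (B \<inter> line p q)" by (rule indep_subset) blast
  then show ?thesis using indep_line_le[OF assms(1-3)] by blast
qed

text \<open>A pair is smaller than a base, so some base augments it. In particular no line is all of
  \<open>E\<close>.\<close>

lemma pair_extends_to_base:
  assumes "p \<in> E" "q \<in> E" "p \<noteq> q"
  obtains c where "c \<in> E - {p, q}" "c \<notin> line p q" "{p, q, c} \<in> \<B>"
proof -
  obtain B where "B \<in> \<B>" using extend_indep[OF indep_empty, of E] bases_iff by blast
  then have "indep B" "card {p, q} < card B" using assms(3) by (auto simp: bases_iff3)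
  then obtain x where x: "x \<in> B - {p, q}" "indep (insert x {p, q})"
    using augment indep_pair assms by blast
  have "card (insert x {p, q}) = 3" using x assms(3) by auto
  then have "{p, q, x} \<in> \<B>" using x by (simp add: bases_iff3 insert_commute)
  moreover have "x \<in> E - {p, q}" using x indep_subset_ground by blast
  ultimately show ?thesis using that by (auto simp: line_def)
qed

text \<open>Connectedness enters here: the line is a nonempty proper subset of rank 2, so 3 is less
  than 2 plus the rank of its complement.\<close>

lemma rank_compl_line:
  assumes "p \<in> E" "q \<in> E" "p \<noteq> q"
  shows "rank_of indep (E - line p q) \<ge> 2"
proof -
  obtain c where "c \<in> E" "c \<notin> line p q"
    using pair_extends_to_base[OF assms] by blast
  then have "line p q \<noteq> {} \<and> line p q \<subset> E" using mem_line line_subset assms by blast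
  then have "rank_of indep E < rank_of indep (line p q) + rank_of indep (E - line p q)"
    using connected unfolding connected_matroid_def by blast
  then show ?thesis using rank_line[OF assms] rank3 by simp
qed

section \<open>Facets and lines with at least three points\<close>

text \<open>Two independent points off the line extend to a base, which then meets the line at most
  once.\<close>

lemma line_face_proper:
  assumes "p \<in> E" "q \<in> E" "p \<noteq> q"
  shows "\<B> \<inter> fam_eq E (line p q) 2 \<noteq> \<B>"
proof -
  obtain I where I: "I \<subseteq> E - line p q" "indep I" "card I \<ge> 2"
    using rank_attained[of "E - line p q"] rank_compl_line[OF assms] by metis
  then obtain B where B: "I \<subseteq> B" "B \<in> \<B>"
    using extend_indep[of I E] indep_subset_ground bases_iff by blast
  then have f: "finite B" "card B = 3" using bases_iff3 finite_indep by auto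
  have "card (B \<inter> line p q) \<le> card (B - I)" using I f by (intro card_mono) auto
  also have "\<dots> \<le> 1" using card_Diff_subset[of I B] I B f finite_indep by simp
  finally have "B \<notin> fam_eq E (line p q) 2" using B(2) by (simp add: base_in_fam)
  then show ?thesis using B(2) by blast
qed

lemma is_face_fam_eq:
  "X \<subseteq> E \<Longrightarrow> is_face E indep (\<B> \<inter> fam_eq E X (int (rank_of indep X)))"
  unfolding is_face_def by (rule exI[of _ "{X}"]) auto

text \<open>
  Swapping one element of a base shows that \<open>X\<close> contains all or none of the line and all or none
  of its complement. The complement itself is excluded: it has rank at least two but meets these
  bases only once.
\<close>

lemma tight_on_line_face:
  assumes pq: "p \<in> E" "q \<in> E" "p \<noteq> q" and big: "card (line p q) \<ge> 3" and X: "X \<subseteq> E"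
    and tight: "\<B> \<inter> fam_eq E (line p q) 2 \<subseteq> fam_eq E X (int (rank_of indep X))"
  shows "X \<in> {{}, line p q, E}"
proof -
  let ?L = "line p q"
  have fL: "finite ?L" using line_subset finite_ground finite_subset by blast
  have t: "card ({a, b, c} \<inter> X) = rank_of indep X"
    if "a \<in> ?L" "b \<in> ?L" "a \<noteq> b" "c \<in> E - ?L" for a b c
  proof -
    have B: "{a, b, c} \<in> \<B>" using base_off_line pq that by blast
    have "{a, b, c} \<inter> ?L = {a, b}" using that by auto
    then have "{a, b, c} \<in> fam_eq E ?L 2" using B that by (simp add: base_in_fam)
    then have "{a, b, c} \<in> fam_eq E X (int (rank_of indep X))" using B tight by blast
    then show ?thesis using B by (simp add: base_in_fam)
  qed
  obtain c0 where c0: "c0 \<in> E - ?L" using pair_extends_to_base[OF pq] by blast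
  have outside: "c \<in> X \<longleftrightarrow> d \<in> X" if "c \<in> E - ?L" "d \<in> E - ?L" for c d
  proof -
    have "card ({p, q, c} \<inter> X) = card ({p, q, d} \<inter> X)"
      using t[of p q] that pq mem_line by simp
    moreover have "p \<noteq> c" "q \<noteq> c" "p \<noteq> d" "q \<noteq> d" using that pq mem_line by auto
    ultimately show ?thesis using pq(3) by (auto simp: Int_insert_left split: if_splits)
  qed
  have inside: "a \<in> X \<longleftrightarrow> b \<in> X" if "a \<in> ?L" "b \<in> ?L" "a \<noteq> b" for a b
  proof -
    \<comment> \<open>A third point \<open>d\<close> of the line gives two bases on the face,
      \<open>{a, d, c0}\<close> and \<open>{b, d, c0}\<close>, that differ only in \<open>a\<close>
      and \<open>b\<close>.\<close>
    have "\<not> ?L \<subseteq> {a, b}"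
      using card_mono[of "{a, b}" ?L] big that by auto
    then obtain d where d: "d \<in> ?L" "d \<noteq> a" "d \<noteq> b" by blast
    have "card ({a, d, c0} \<inter> X) = card ({b, d, c0} \<inter> X)"
      using t[of a d c0] t[of b d c0] that d c0 by simp
    moreover have "a \<noteq> c0" "b \<noteq> c0" "d \<noteq> c0" using that d c0 by auto
    ultimately show ?thesis using that d by (auto simp: Int_insert_left split: if_splits)
  qed
  have not_compl: "X \<noteq> E - ?L"
  proof
    assume eq: "X = E - ?L"
    have "{p, q, c0} \<inter> X = {c0}" using c0 eq pq mem_line by auto
    then have "rank_of indep X = 1" using t[of p q c0] pq mem_line c0 by simp
    then show False using rank_compl_line[OF pq] eq by simp
  qed
  have "X \<inter> ?L = {} \<or> ?L \<subseteq> X" using inside by blast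
  moreover have "X \<inter> (E - ?L) = {} \<or> E - ?L \<subseteq> X" using outside by blast
  ultimately have "X = {} \<or> X = ?L \<or> X = E - ?L \<or> X = E"
    using X line_subset[of p q] by blast
  then show ?thesis using not_compl by blast
qed

text \<open>A proper face above this one satisfies the equation of some \<open>X\<close> that a base
  violates. Such an \<open>X\<close> is tight on the face of the line, hence is empty, the line or
  \<open>E\<close>. The empty set and \<open>E\<close> are tight for every base, so \<open>X\<close>
  is the line and both faces agree.\<close>

lemma long_line_facet_defining:
  assumes pq: "p \<in> E" "q \<in> E" "p \<noteq> q" and big: "card (line p q) \<ge> 3"
  shows "facet_defining E indep (line p q) 2"
proof -
  let ?L = "line p q"
  let ?F = "\<B> \<inter> fam_eq E ?L 2"
  have r: "rank_of indep ?L = 2" using rank_line[OF pq] .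
  have face: "is_face E indep ?F"
    using is_face_fam_eq[OF line_subset, of p q] r by simp
  have "\<G> = ?F" if G: "is_face E indep \<G>" "\<G> \<noteq> \<B>" "?F \<subseteq> \<G>" for \<G>
  proof -
    obtain \<A> where A: "\<A> \<subseteq> Pow E"
      "\<G> = \<B> \<inter> (\<Inter>X\<in>\<A>. fam_eq E X (int (rank_of indep X)))"
      using G(1) unfolding is_face_def by blast
    then obtain X B where X: "X \<in> \<A>" "B \<in> \<B>" "B \<notin> fam_eq E X (int (rank_of indep X))"
      using G(2) by blast
    have "X \<subseteq> E" using X A by blast
    moreover have "?F \<subseteq> fam_eq E X (int (rank_of indep X))" using G(3) A X by blast
    ultimately have "X \<in> {{}, ?L, E}" using tight_on_line_face[OF pq big] by blast
    moreover have "X \<noteq> {}"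
    proof
      assume "X = {}"
      moreover have "rank_of indep {} \<le> 0" by (rule rank_leI) simp
      ultimately show False using X(2,3) by (simp add: base_in_fam)
    qed
    moreover have "X \<noteq> E"
    proof
      assume "X = E"
      moreover have "B \<inter> E = B" using X(2) base_subset by blast
      moreover have "card B = 3" using X(2) by (simp add: bases_iff3)
      ultimately show False using X(2,3) rank3 by (simp add: base_in_fam)
    qed
    ultimately have "X = ?L" by blast
    then have "\<G> \<subseteq> ?F" using A X r by auto
    then show ?thesis using G(3) by blast
  qed
  then show ?thesis
    unfolding facet_defining_def is_facet_def
    using face line_face_proper[OF pq] r line_subset by auto
qed

text \<open>Rank two puts \<open>F\<close> inside the line, so the face of \<open>F\<close> lies in
  that of the line, and maximality makes them equal. A point \<open>e\<close> of the line outside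
  \<open>F\<close> would give a base \<open>{a, e, c}\<close>, with \<open>c\<close> off the line,
  that is on the face of the line but meets \<open>F\<close> only in \<open>a\<close>.\<close>

lemma facet_defining_closed:
  assumes F: "facet_defining E indep F 2" and ab: "a \<in> F" "b \<in> F" "a \<noteq> b"
  shows "line a b = F"
proof -
  have FE: "F \<subseteq> E" and r: "rank_of indep F = 2"
    and fac: "is_facet E indep (\<B> \<inter> fam_eq E F 2)"
    using F by (auto simp: facet_defining_def)
  let ?L = "line a b"
  have abE: "a \<in> E" "b \<in> E" using ab FE by auto
  have FL: "F \<subseteq> ?L"
  proof
    fix f assume f: "f \<in> F"
    have "{a, b, f} \<notin> \<B>"
    proof
      assume "{a, b, f} \<in> \<B>"
      then have "indep {a, b, f}" "card {a, b, f} = 3" by (auto simp only: bases_iff3)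
      then show False using card_le_rank[of "{a, b, f}" F] r f ab by simp
    qed
    then show "f \<in> ?L" using f FE by (auto simp: line_def)
  qed
  have "is_face E indep (\<B> \<inter> fam_eq E ?L 2)"
    using is_face_fam_eq[OF line_subset, of a b] rank_line[OF abE ab(3)] by simp
  moreover have "\<B> \<inter> fam_eq E F 2 \<subseteq> \<B> \<inter> fam_eq E ?L 2"
  proof
    fix B assume B: "B \<in> \<B> \<inter> fam_eq E F 2"
    then have "finite B" using bases_iff3 finite_indep by blast
    then have "card (B \<inter> F) \<le> card (B \<inter> ?L)" using FL by (intro card_mono) auto
    moreover have "card (B \<inter> ?L) \<le> 2" using base_inter_line_le abE ab B by blast
    ultimately show "B \<in> \<B> \<inter> fam_eq E ?L 2" using B by (auto simp: base_in_fam)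
  qed
  ultimately have eq: "\<B> \<inter> fam_eq E ?L 2 = \<B> \<inter> fam_eq E F 2"
    using fac line_face_proper[OF abE ab(3)] unfolding is_facet_def by blast
  have "?L \<subseteq> F"
  proof
    fix e assume e: "e \<in> ?L"
    show "e \<in> F"
    proof (rule ccontr)
      assume ne: "e \<notin> F"
      obtain c where c: "c \<in> E" "c \<notin> ?L" using pair_extends_to_base[OF abE ab(3)] by blast
      have ae: "a \<in> ?L" "a \<noteq> e" using ab FL ne by auto
      have B: "{a, e, c} \<in> \<B>" using base_off_line[OF abE ab(3) ae(1) e ae(2) c] .
      have "{a, e, c} \<inter> ?L = {a, e}" using c ae e by auto
      then have "{a, e, c} \<in> \<B> \<inter> fam_eq E ?L 2"
        using B ae(2) by (simp add: base_in_fam)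
      then have "{a, e, c} \<in> fam_eq E F 2" using eq by blast
      then have "card ({a, e, c} \<inter> F) = 2" using B by (simp add: base_in_fam)
      moreover have "{a, e, c} \<inter> F = {a}" using ab ne c FL by auto
      ultimately show False by simp
    qed
  qed
  then show ?thesis using FL by blast
qed

section \<open>Necessity of the facet condition\<close>

lemma facet_condition_if_two_decomposable:
  assumes dec: "base_family_on E (\<B> \<inter> fam_ge E A 2)" and A: "A \<subseteq> E"
    and rA: "rank_of indep A = 3" and F: "facet_defining E indep F 2"
  shows "card (A \<inter> F) \<le> 1 \<or> F \<subseteq> A \<or> A \<union> F = E"
proof (rule ccontr)
  assume no: "\<not> ?thesis"
  have FE: "F \<subseteq> E" and r: "rank_of indep F = 2" using F by (auto simp: facet_defining_def)
  \<comment> \<open>\<open>f\<close> witnesses that \<open>F\<close> is not inside \<open>A\<close>,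
    and \<open>e\<close> that \<open>A \<union> F\<close> is not \<open>E\<close>.\<close>
  obtain f e where f: "f \<in> F" "f \<notin> A" and e: "e \<in> E" "e \<notin> A" "e \<notin> F"
    using no A FE by blast
  have "card (A \<inter> F) \<ge> 2" using no by simp
  then obtain S where "S \<subseteq> A \<inter> F" "card S = 2" by (meson obtain_subset_with_card_n)
  then obtain a b where ab: "a \<in> A \<inter> F" "b \<in> A \<inter> F" "a \<noteq> b"
    by (auto simp: card_2_iff)
  have line: "line a b = F" "line a f = F"
    using facet_defining_closed[OF F] ab f by auto
  \<comment> \<open>As \<open>A\<close> has rank 3 and \<open>F\<close> rank 2, \<open>A\<close>
    contains a point \<open>c\<close> off \<open>F\<close>.\<close>
  obtain I where I: "I \<subseteq> A" "indep I" "card I = 3" using rank_attained[of A] rA by auto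
  then have "\<not> I \<subseteq> F" using card_le_rank[of I F] r by auto
  then obtain c where c: "c \<in> A" "c \<notin> F" using I by blast
  have B: "{a, b, e} \<in> \<B>" and C: "{a, f, c} \<in> \<B>"
    using line e c A by (auto simp: line_def)
  have af: "a \<noteq> f" "c \<noteq> a" "c \<noteq> f" using ab f c by auto
  have "{a, b, e} \<inter> A = {a, b}" "{a, f, c} \<inter> A = {a, c}" using ab e f c by auto
  then have "{a, b, e} \<in> \<B> \<inter> fam_ge E A 2" "{a, f, c} \<in> \<B> \<inter> fam_ge E A 2"
    using B C ab(3) af(2) by (simp_all add: base_in_fam)
  moreover have "c \<in> {a, f, c} - {a, b, e}" using c ab e by auto
  ultimately obtain y where y: "y \<in> {a, b, e} - {a, f, c}"
    and D: "insert y ({a, f, c} - {c}) \<in> \<B> \<inter> fam_ge E A 2"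
    using base_family_on_exchange[OF dec, of "{a, f, c}" "{a, b, e}" c] by blast
  have "{a, f, c} - {c} = {a, f}" using af by auto
  then have D': "{y, a, f} \<in> \<B> \<inter> fam_ge E A 2" using D by simp
  \<comment> \<open>Neither replacement for \<open>c\<close> works: \<open>b\<close> puts all three
    points in the rank-two set \<open>F\<close>, and \<open>e\<close> leaves \<open>a\<close> as the
    only point in \<open>A\<close>.\<close>
  have "y = b \<or> y = e" using y by auto
  then show False
  proof
    assume "y = b"
    then have "{b, a, f} \<in> \<B>" using D' by simp
    then show False
      using card_le_rank[of "{b, a, f}" F] r ab f unfolding bases_iff3 by simp
  next
    assume "y = e"
    moreover have "{e, a, f} \<inter> A = {a}" using ab e f by auto
    moreover have "{y, a, f} \<in> \<B>" "{y, a, f} \<in> fam_ge E A 2" using D' by blast+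
    ultimately show False by (simp add: base_in_fam)
  qed
qed

section \<open>Sufficiency of the three conditions\<close>

text \<open>The points that can replace \<open>x\<close> in the base \<open>B\<close> are exactly
  those of \<open>E\<close> off \<open>line p q\<close>, so exchange becomes a question about this
  line.\<close>

lemma exchange_line:
  assumes "B \<in> \<B>" "x \<in> B"
  obtains p q where "B = {x, p, q}" "x \<noteq> p" "x \<noteq> q" "p \<noteq> q" "p \<in> E" "q \<in> E"
    "x \<in> E" "x \<notin> line p q"
proof -
  have "card B = 3" "finite B" using assms bases_iff3 finite_indep by auto
  then have "card (B - {x}) = 2" using assms(2) by simp
  then obtain p q where pq: "B - {x} = {p, q}" "p \<noteq> q" by (auto simp: card_2_iff)
  have B: "B = {x, p, q}" using pq assms(2) by blast
  moreover have "{p, q, x} = B" using B by auto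
  then have "x \<notin> line p q" using assms by (simp add: line_def)
  ultimately show ?thesis using that[of p q] pq assms base_subset by blast
qed

text \<open>The points \<open>s\<close>, \<open>t\<close>, \<open>u\<close> make the line long
  enough to be facet-defining. Then \<open>s\<close> and \<open>t\<close> exclude the first
  alternative of the facet condition and \<open>u\<close> the second.\<close>

lemma line_condition:
  assumes cond: "\<And>F. facet_defining E indep F 2 \<Longrightarrow>
      card (A \<inter> F) \<le> 1 \<or> F \<subseteq> A \<or> A \<union> F = E"
    and pq: "p \<in> E" "q \<in> E" "p \<noteq> q"
    and two: "s \<in> A \<inter> line p q" "t \<in> A \<inter> line p q" "s \<noteq> t"
    and u: "u \<in> line p q" "u \<notin> A"
  shows "A \<union> line p q = E"
proof -
  have f: "finite (line p q)" using line_subset finite_ground finite_subset by blast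
  have "card {s, t, u} = 3" using two u by (auto simp: card_insert_if)
  moreover have "card {s, t, u} \<le> card (line p q)"
    using two u f by (intro card_mono) auto
  ultimately have "facet_defining E indep (line p q) 2"
    using long_line_facet_defining[OF pq] by simp
  moreover have "card {s, t} \<le> card (A \<inter> line p q)"
    using two f by (intro card_mono) auto
  ultimately show ?thesis using cond[of "line p q"] u two by auto
qed

text \<open>Each exchange splits by whether the points \<open>p\<close> and \<open>q\<close> kept
  from \<open>B\<close> both lie in \<open>A\<close>. In one case every basis exchange stays in the
  family; in the other the replacement is taken from \<open>C\<close> off \<open>line p q\<close>
  and on the required side of \<open>A\<close>.\<close>

lemma two_decomposable_if_facet_condition:
  assumes A: "A \<subseteq> E" and compl: "card (E - A) \<ge> 2" and rA: "rank_of indep A = 3"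
    and cond: "\<And>F. facet_defining E indep F 2 \<Longrightarrow>
      card (A \<inter> F) \<le> 1 \<or> F \<subseteq> A \<or> A \<union> F = E"
  shows "two_decomposable E \<B> A 2"
proof -
  obtain I where I: "I \<subseteq> A" "indep I" "card I = 3" using rank_attained[of A] rA by auto
  have "I \<inter> A = I" using I by blast
  then have greater: "I \<in> \<B> \<inter> fam_greater E A 2"
    using I by (simp add: base_in_fam bases_iff3)
  \<comment> \<open>A base through two points outside \<open>A\<close> has at most one point in
    \<open>A\<close>.\<close>
  obtain S where "S \<subseteq> E - A" "card S = 2" using compl by (meson obtain_subset_with_card_n)
  then obtain u v where uv: "u \<in> E - A" "v \<in> E - A" "u \<noteq> v" by (auto simp: card_2_iff)
  then obtain w where w: "{u, v, w} \<in> \<B>" using pair_extends_to_base[of u v] by blast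
  have "card ({u, v, w} \<inter> A) \<le> card {w}" using uv by (intro card_mono) auto
  then have less: "{u, v, w} \<in> \<B> \<inter> fam_less E A 2"
    using w by (simp add: base_in_fam)
  have ge: "base_family_on E (\<B> \<inter> fam_ge E A 2)"
  proof (rule base_family_on_exchangeI[where n = 3])
    show "\<B> \<inter> fam_ge E A 2 \<noteq> {}" using greater by (auto simp: fam_ge_def fam_greater_def)
    fix B C x
    assume B: "B \<in> \<B> \<inter> fam_ge E A 2" and C: "C \<in> \<B> \<inter> fam_ge E A 2" and x: "x \<in> B - C"
    obtain p q where pq: "B = {x, p, q}" "x \<noteq> p" "x \<noteq> q" "p \<noteq> q" "p \<in> E" "q \<in> E"
      "x \<in> E" "x \<notin> line p q" using exchange_line[of B x] B x by blast
    have Bx: "B - {x} = {p, q}" using pq by auto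
    have two: "2 \<le> card (B \<inter> A)" "2 \<le> card (C \<inter> A)" using B C by (auto simp: fam_ge_def)
    show "\<exists>y\<in>C - B. insert y (B - {x}) \<in> \<B> \<inter> fam_ge E A 2"
    proof (cases "p \<in> A \<and> q \<in> A")
      case True
      obtain y where y: "y \<in> C - B" "insert y (B - {x}) \<in> \<B>"
        using bases_exchange[of B C x] B C x by blast
      have "card {p, q} \<le> card (insert y (B - {x}) \<inter> A)"
        using True Bx by (intro card_mono) auto
      then have "insert y (B - {x}) \<in> fam_ge E A 2"
        using y(2) pq(4) by (simp add: base_in_fam)
      then show ?thesis using y by blast
    next
      case False
      obtain S where "S \<subseteq> C \<inter> A" "card S = 2" using two by (meson obtain_subset_with_card_n)
      then obtain s t where st: "s \<in> C \<inter> A" "t \<in> C \<inter> A" "s \<noteq> t" by (auto simp: card_2_iff)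
      \<comment> \<open>Otherwise the line contains \<open>s\<close> and \<open>t\<close> from
        \<open>A\<close> and one of \<open>p\<close>, \<open>q\<close> outside \<open>A\<close>, so
        it covers \<open>E - A\<close>. Then all of \<open>C\<close> would lie on the line.\<close>
      obtain y where y: "y \<in> C \<inter> A" "y \<notin> line p q"
      proof (rule ccontr)
        assume "\<not> thesis"
        then have sub: "C \<inter> A \<subseteq> line p q" using that by blast
        have "A \<union> line p q = E"
        proof -
          obtain u where u: "u \<in> {p, q}" "u \<notin> A" using False by blast
          then have "u \<in> line p q" using mem_line pq by blast
          moreover have "s \<in> A \<inter> line p q" "t \<in> A \<inter> line p q" using st sub by blast+
          ultimately show ?thesis using line_condition[OF cond pq(5,6,4)] st(3) u(2) by blast
        qed
        then have "C \<subseteq> line p q" using sub base_subset[of C] C by blast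
        then have "C \<inter> line p q = C" by blast
        then show False using base_inter_line_le[OF pq(5,6,4), of C] C by (simp add: bases_iff3)
      qed
      have yE: "y \<in> E" using y A by blast
      have ypq: "y \<noteq> p" "y \<noteq> q" using y pq mem_line by auto
      have "{p, q, y} \<in> \<B>" using y yE by (simp add: line_def)
      then have base: "insert y (B - {x}) \<in> \<B>" using Bx by (simp add: insert_commute)
      \<comment> \<open>\<open>B\<close> has two points in \<open>A\<close>, but \<open>p\<close>
        and \<open>q\<close> are not both there. The one that is, together with \<open>y\<close>,
        gives two points of \<open>A\<close> in the new base.\<close>
      have "x \<in> A \<and> (p \<in> A \<or> q \<in> A)"
        using two(1) pq False by (auto simp: Int_insert_left split: if_splits)
      then obtain z where z: "z \<in> {p, q}" "z \<in> A" by blast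
      then have "card {y, z} \<le> card (insert y (B - {x}) \<inter> A)"
        using y Bx by (intro card_mono) auto
      moreover have "y \<noteq> z" using z ypq by auto
      ultimately have "insert y (B - {x}) \<in> fam_ge E A 2"
        using base by (simp add: base_in_fam)
      moreover have "y \<in> C - B" using y pq ypq x by auto
      ultimately show ?thesis using base by blast
    qed
  qed (use finite_ground base_subset bases_iff3 in auto)
  have le: "base_family_on E (\<B> \<inter> fam_le E A 2)"
  proof (rule base_family_on_exchangeI[where n = 3])
    show "\<B> \<inter> fam_le E A 2 \<noteq> {}" using less by (auto simp: fam_le_def fam_less_def)
    fix B C x
    assume B: "B \<in> \<B> \<inter> fam_le E A 2" and C: "C \<in> \<B> \<inter> fam_le E A 2" and x: "x \<in> B - C"
    obtain p q where pq: "B = {x, p, q}" "x \<noteq> p" "x \<noteq> q" "p \<noteq> q" "p \<in> E" "q \<in> E"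
      "x \<in> E" "x \<notin> line p q" using exchange_line[of B x] B x by blast
    have Bx: "B - {x} = {p, q}" using pq by auto
    have two: "card (B \<inter> A) \<le> 2" "card (C \<inter> A) \<le> 2" using B C by (auto simp: fam_le_def)
    show "\<exists>y\<in>C - B. insert y (B - {x}) \<in> \<B> \<inter> fam_le E A 2"
    proof (cases "p \<in> A \<and> q \<in> A")
      case False
      obtain y where y: "y \<in> C - B" "insert y (B - {x}) \<in> \<B>"
        using bases_exchange[of B C x] B C x by blast
      obtain z where z: "{p, q} \<inter> A \<subseteq> {z}" using False by blast
      have "card (insert y (B - {x}) \<inter> A) \<le> card {y, z}"
        using z Bx by (intro card_mono) auto
      also have "\<dots> \<le> 2" by (simp add: card_insert_if)
      finally have "insert y (B - {x}) \<in> fam_le E A 2"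
        using y(2) by (simp add: base_in_fam)
      then show ?thesis using y by blast
    next
      case True
      have xA: "x \<notin> A" using two(1) pq True by (auto simp: Int_insert_left)
      have "\<not> C \<subseteq> A"
      proof
        assume "C \<subseteq> A"
        then have "C \<inter> A = C" by blast
        then show False using two(2) C by (simp add: bases_iff3)
      qed
      then obtain c where c: "c \<in> C" "c \<notin> A" by blast
      \<comment> \<open>If \<open>c\<close> were on the line, the line would contain
        \<open>p\<close>, \<open>q\<close> in \<open>A\<close> and \<open>c\<close> outside, hence
        cover \<open>E - A\<close>; but \<open>x\<close> lies neither in \<open>A\<close> nor on the
        line.\<close>
      have cl: "c \<notin> line p q"
      proof
        assume "c \<in> line p q"
        moreover have "p \<in> A \<inter> line p q" "q \<in> A \<inter> line p q"
          using True mem_line pq by blast+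
        ultimately have "A \<union> line p q = E"
          using line_condition[OF cond pq(5,6,4)] pq(4) c(2) by blast
        then show False using xA pq by blast
      qed
      have cE: "c \<in> E" using c C base_subset by blast
      have "{p, q, c} \<in> \<B>" using cl cE by (simp add: line_def)
      then have base: "insert c (B - {x}) \<in> \<B>" using Bx by (simp add: insert_commute)
      have "card (insert c (B - {x}) \<inter> A) \<le> card {p, q}"
        using c Bx by (intro card_mono) auto
      then have "insert c (B - {x}) \<in> fam_le E A 2"
        using base pq(4) by (simp add: base_in_fam)
      moreover have "c \<in> C - B" using c pq True x by auto
      ultimately show ?thesis using base by blast
    qed
  qed (use finite_ground base_subset bases_iff3 in auto)
  show ?thesis unfolding two_decomposable_def using ge le greater less by blast
qed

end

section \<open>Both directions of the characterization of 2-decomposability\<close>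

theorem theorem4p6:
  fixes E :: "'a set" and indep :: "'a set \<Rightarrow> bool" and A :: "'a set"
  assumes "matroid E indep"
    and "connected_matroid E indep"
    and "simple_matroid E indep"
    and "rank_of indep E = 3"
    and "A \<subseteq> E"
  shows "two_decomposable E (bases indep) A 2 \<longleftrightarrow>
    card (E - A) \<ge> 2 \<and>
    rank_of indep A = 3 \<and>
    (\<forall>F. F \<subseteq> E \<and> facet_defining E indep F 2 \<longrightarrow>
      card (A \<inter> F) \<le> 1 \<or> F \<subseteq> A \<or> A \<union> F = E)"
proof -
  interpret matroid E indep by (rule assms(1))
  interpret connected_simple_rank3 E indep
    by unfold_locales (rule assms)+
  show ?thesis (is "?D \<longleftrightarrow> ?C")
  proof
    assume ?D
    then have ge: "base_family_on E (\<B> \<inter> fam_ge E A 2)"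
      and less: "\<B> \<inter> fam_less E A 2 \<noteq> {}" and greater: "\<B> \<inter> fam_greater E A 2 \<noteq> {}"
      unfolding two_decomposable_def by simp_all
    from less obtain B where "B \<in> \<B>" "B \<in> fam_less E A 2" by blast
    then have B: "B \<in> \<B>" "card (B \<inter> A) < 2" by (simp_all add: base_in_fam)
    from greater obtain G where "G \<in> \<B>" "G \<in> fam_greater E A 2" by blast
    then have G: "G \<in> \<B>" "card (G \<inter> A) > 2" by (simp_all add: base_in_fam)
    have B3: "card B = 3" "finite B" using B bases_iff3 finite_indep by auto
    \<comment> \<open>Fewer than two of the three points of \<open>B\<close> lie in
      \<open>A\<close>, so at least two lie in \<open>E - A\<close>.\<close>
    have "card (B \<inter> A) + card (B - A) = card B"
      using B3 card_Int_Diff by metis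
    moreover have "card (B - A) \<le> card (E - A)"
      using base_subset[OF B(1)] finite_ground by (intro card_mono) auto
    ultimately have "card (E - A) \<ge> 2" using B B3 by simp
    moreover have rA: "rank_of indep A = 3"
    proof (rule antisym)
      show "rank_of indep A \<le> 3"
      proof (rule rank_leI)
        fix I assume "indep I"
        then show "card I \<le> 3" using card_le_rank[of I E] indep_subset_ground rank3 by simp
      qed
      \<comment> \<open>\<open>G\<close> has more than two points in \<open>A\<close>, which form an
        independent set of size at least three.\<close>
      have "indep (G \<inter> A)" using G indep_subset bases_iff3 by blast
      then show "3 \<le> rank_of indep A" using card_le_rank[of "G \<inter> A" A] G by simp
    qed
    ultimately show ?C
      using facet_condition_if_two_decomposable[OF ge \<open>A \<subseteq> E\<close> rA] by blast
  next
    assume ?C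
    then show ?D
      using two_decomposable_if_facet_condition[OF \<open>A \<subseteq> E\<close>] facet_defining_def by metis
  qed
qed

end
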